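(* Let $X=(X,\succcurlyeq_X)$ be a partially ordered Hilbert space with $\dim X\geq 2$, and let $Y=(Y,\succcurlyeq_Y)$ be any Hilbert poset. Then $(X,Y)$ has the monotone Lipschitz extension property if, and only if, $\succcurlyeq_X$ is trivial.
   Context: All linear spaces are real. A partial order is a reflexive, transitive, antisymmetric binary relation. The trivial order on a set $X$ is the equality relation $\{(x,x):x\in X\}$. A vector order on a linear space $X$ is a partial order $\succcurlyeq$ on $X$ such that $x\succcurlyeq y$ implies $\lambda x\succcurlyeq\lambda y$ for all real $\lambda\geq 0$ and $x+z\succcurlyeq y+z$ for all $z\in X$. A partially ordered Hilbert space is a Hilbert space (possibly infinite-dimensional) together with a vector order on it (not assumed closed). A Hilbert poset is a partially ordered Hilbert space $(Y,\succcurlyeq)$ such that $\succcurlyeq$ is a closed subset of $Y\times Y$. Hilbert spaces are viewed as metric spaces via the norm, with metrics denoted $d_X$ and $d_Y$. For a nonempty $S\subseteq X$ (with the induced metric and order), a map $f:S\to Y$ is order-preserving if $x\succcurlyeq_X y$ implies $f(x)\succcurlyeq_Y f(y)$ for all $x,y\in S$; it is 1-Lipschitz if $d_Y(f(x),f(y))\leq d_X(x,y)$ for all $x,y\in S$. The pair $(X,Y)$ has the monotone Lipschitz extension property if for every nonempty $S\subseteq X$ and every order-preserving 1-Lipschitz map $f:S\to Y$, there is an order-preserving 1-Lipschitz map $F:X\to Y$ with $F|_S=f$.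
   Formalization: Two cases where the claim fails are excluded: Y = {0} (every pair then has the property), and Y trivially ordered with X totally ordered, e.g. X the lexicographic plane and Y = R with equality (order-preserving maps are then constant and extend). *)

theory Defs
  imports "HOL-Analysis.Analysis"
begin

text \<open>
  Hilbert spaces are types of sort \<open>{real_inner, complete_space}\<close>. An order is a set of
  pairs, with \<open>(x, y) \<in> r\<close> read as ``\<open>x\<close> dominates \<open>y\<close>''. The trivial order is \<open>Id\<close>.
\<close>

definition vector_order :: "('a::real_vector \<times> 'a) set \<Rightarrow> bool" where
  "vector_order r \<longleftrightarrow>
     partial_order_on UNIV r \<and>
     (\<forall>x y. \<forall>c\<ge>0. (x, y) \<in> r \<longrightarrow> (c *\<^sub>R x, c *\<^sub>R y) \<in> r) \<and>
     (\<forall>x y z. (x, y) \<in> r \<longrightarrow> (x + z, y + z) \<in> r)"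

definition hilbert_poset :: "('a::{real_inner, complete_space} \<times> 'a) set \<Rightarrow> bool" where
  "hilbert_poset r \<longleftrightarrow> vector_order r \<and> closed r"

definition order_preserving_on ::
    "'a set \<Rightarrow> ('a \<times> 'a) set \<Rightarrow> ('b \<times> 'b) set \<Rightarrow> ('a \<Rightarrow> 'b) \<Rightarrow> bool" where
  "order_preserving_on S r s f \<longleftrightarrow> (\<forall>x\<in>S. \<forall>y\<in>S. (x, y) \<in> r \<longrightarrow> (f x, f y) \<in> s)"

definition monotone_lipschitz_extension_property ::
    "('a::metric_space \<times> 'a) set \<Rightarrow> ('b::metric_space \<times> 'b) set \<Rightarrow> bool" where
  "monotone_lipschitz_extension_property r s \<longleftrightarrow>
     (\<forall>S f. S \<noteq> {} \<longrightarrow> order_preserving_on S r s f \<longrightarrow> 1-lipschitz_on S f \<longrightarrow>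
        (\<exists>F. order_preserving_on UNIV r s F \<and> 1-lipschitz_on UNIV F \<and> (\<forall>x\<in>S. F x = f x)))"

text \<open>
  The next two lemmas give degenerate cases in which the extension property holds for every
  order, respectively every total order, on the domain: the codomain is the zero space, or it
  carries the trivial order. The latter is relevant because vector orders need not be closed;
  the lexicographic order of the plane is a total vector order.
\<close>

lemma monotone_lipschitz_extension_property_zero_codomain:
  fixes r :: "('a::metric_space \<times> 'a) set" and s :: "('b::real_normed_vector \<times> 'b) set"
  assumes "\<And>y::'b. y = 0" "refl s"
  shows "monotone_lipschitz_extension_property r s"
proof -
  have eq: "x = y" for x y :: 'b
    using assms(1) by metis
  have "(x, y) \<in> s" for x y :: 'b
    using assms(2) eq[of x y] by (simp add: refl_on_def)
  then have "order_preserving_on UNIV r s f" "1-lipschitz_on UNIV f" for f :: "'a \<Rightarrow> 'b"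
    using eq by (auto simp: order_preserving_on_def lipschitz_on_def) 
       (metis dist_self zero_le_dist)
  then show ?thesis
    unfolding monotone_lipschitz_extension_property_def by blast
qed

lemma monotone_lipschitz_extension_property_total_trivial:
  fixes r :: "('a::metric_space \<times> 'a) set"
  assumes "total r"
  shows "monotone_lipschitz_extension_property r (Id :: ('b::metric_space \<times> 'b) set)"
  unfolding monotone_lipschitz_extension_property_def
proof (intro allI impI)
  fix S :: "'a set" and f :: "'a \<Rightarrow> 'b"
  assume "S \<noteq> {}" and f: "order_preserving_on S r Id f"
  then obtain a where a: "a \<in> S" by blast
  have "f x = f a" if "x \<in> S" for x
    using f a that assms unfolding order_preserving_on_def total_on_def by (metis UNIV_I pair_in_Id_conv)
  then show "\<exists>F. order_preserving_on UNIV r Id F \<and> 1-lipschitz_on UNIV F \<and> (\<forall>x\<in>S. F x = f x)"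
    by (intro exI[of _ "\<lambda>_. f a"]) (auto simp: order_preserving_on_def lipschitz_on_def)
qed

end

theory Submission
  imports Defs
begin

text \<open>
  For the trivial order on the domain, every map is order-preserving, and the claim is the
  Kirszbraun--Valentine theorem for Hilbert spaces of any dimension (\<open>kirszbraun\<close>). By a maximality
  argument it suffices to add one point, which means to find a common point of closed balls. Finitely
  many of these balls meet because the minimizer of the largest excess is a barycenter of the
  centers of the active balls, and barycenters satisfy a variance inequality
  (\<open>short_relation_finite_point\<close>); infinitely many meet because bounded closed convex sets with the
  finite intersection property have a common point (\<open>closed_convex_finite_intersection\<close>).

  For a nontrivial order on the domain, a map on two points without a monotone 1-Lipschitz extension
  is exhibited. If the order is not total, take \<open>a\<close> incomparable to 0 and a positive \<open>v\<close> with
  \<open>inner a v > 0\<close>. The map may send \<open>a\<close> against a vector of the dual cone of the codomain, while a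
  multiple of \<open>v\<close> that is too close to \<open>a\<close> must be sent to a positive vector
  (\<open>no_extension_nontotal\<close>). If the order is total, its cone cannot be closed in dimension at least
  two, as in the lexicographic plane; then some \<open>u \<noteq> 0\<close> is positive and the limit of negative
  vectors, so that monotone continuous maps into a closed order identify 0 and \<open>u\<close>. This
  contradicts the extension property if the codomain has a nonzero positive vector
  (\<open>no_extension_total\<close>).
\<close>

section \<open>Bounded closed convex sets in Hilbert spaces\<close>

text \<open>
  This is the part of weak compactness of bounded closed convex sets that the extension argument
  consumes, obtained without the weak topology. The distance \<open>d F\<close> from the origin to a finite
  intersection is bounded because of \<open>B\<close>; let \<open>D\<close> be its supremum. By the
  parallelogram law, two points of norm nearly \<open>D\<close> in a convex set at distance nearly \<open>D\<close> from the
  origin are close to each other. Near-minimizers of finite intersections therefore form a Cauchy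
  family, and any further member of \<open>C\<close> may be thrown into the finite intersections without moving
  the limit.
\<close>

lemma closed_convex_finite_intersection:
  fixes C :: "'a::{real_inner, complete_space} set set"
  assumes closed: "\<And>A. A \<in> C \<Longrightarrow> closed A" and convex: "\<And>A. A \<in> C \<Longrightarrow> convex A"
    and B: "B \<in> C" "bounded B"
    and fip: "\<And>F. finite F \<Longrightarrow> F \<subseteq> C \<Longrightarrow> F \<noteq> {} \<Longrightarrow> \<Inter>F \<noteq> {}"
  shows "\<Inter>C \<noteq> {}"
proof -
  define Fin where "Fin = {F. finite F \<and> F \<subseteq> C \<and> B \<in> F}"
  define d where "d F = infdist 0 (\<Inter>F)" for F :: "'a set set"
  define D where "D = (SUP F\<in>Fin. d F)"
  define e where "e n = inverse (real (Suc n))" for n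
  define K where "K n = {p. \<exists>F\<in>Fin. D - e n < d F \<and> p \<in> \<Inter>F \<and> norm p < D + e n}" for n
  define b where "b n = 8 * sqrt (e n * (D + 1))" for n
  have e_pos: "e n > 0" and e_le: "e n \<le> 1" for n
    by (auto simp: e_def divide_simps)
  have e_mono: "e m \<le> e n" if "n \<le> m" for m n
    using that by (simp add: e_def divide_simps)
  have ne: "\<Inter>F \<noteq> {}" if "F \<in> Fin" for F
    using that fip[of F] by (auto simp: Fin_def)
  have d_le: "d F \<le> norm p" if "p \<in> \<Inter>F" for p F
    using infdist_le[OF that, of 0] by (simp add: d_def)
  obtain R where R: "\<And>x. x \<in> B \<Longrightarrow> norm x \<le> R"
    using B(2) by (auto simp: bounded_iff)
  have "d F \<le> R" if F: "F \<in> Fin" for F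
  proof -
    obtain p where p: "p \<in> \<Inter>F" using ne[OF F] by blast
    then have "norm p \<le> R" using R[of p] F by (simp add: Fin_def)
    then show ?thesis using d_le[OF p] by linarith
  qed
  then have bdd: "bdd_above (d ` Fin)"
    by (auto simp: bdd_above_def)
  have Fin_B: "{B} \<in> Fin" using B by (auto simp: Fin_def)
  have d_D: "d F \<le> D" if "F \<in> Fin" for F
    unfolding D_def by (rule cSUP_upper[OF that bdd])
  have D_nonneg: "D \<ge> 0"
    using d_D[OF Fin_B] infdist_nonneg[of 0 "\<Inter>{B}"] unfolding d_def by linarith
  have near: "\<exists>p\<in>\<Inter>F. norm p < D + e n" if F: "F \<in> Fin" for F n
  proof -
    have "infdist 0 (\<Inter>F) < D + e n"
      using d_D[OF F] e_pos[of n] by (simp add: d_def)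
    then have "(INF a\<in>\<Inter>F. dist 0 a) < D + e n"
      using ne[OF F] by (simp add: infdist_notempty)
    then show ?thesis
      using ne[OF F] by (subst (asm) cINF_less_iff) (auto intro!: bdd_belowI[of _ 0])
  qed
  have union: "F \<union> G \<in> Fin" if "F \<in> Fin" "G \<in> Fin" for F G
    using that by (auto simp: Fin_def)
  have meet: "\<exists>p\<in>K n. p \<in> \<Inter>F" if F: "F \<in> Fin" for F n
  proof -
    have "D - e n < (SUP F\<in>Fin. d F)"
      using e_pos[of n] by (simp add: D_def)
    then obtain F0 where F0: "F0 \<in> Fin" "D - e n < d F0"
      using Fin_B bdd by (subst (asm) less_cSUP_iff) auto
    obtain p where p: "p \<in> \<Inter>(F \<union> F0)" "norm p < D + e n"
      using near[OF union[OF F F0(1)]] by blast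
    have "p \<in> K n"
      unfolding K_def using p F0 by blast
    then show ?thesis using p by blast
  qed
  \<comment> \<open>The midpoint lies in the convex set, hence its norm is at least \<open>d F\<close>.\<close>
  have half: "dist p r \<le> 4 * sqrt (e n * (D + 1))"
    if F: "F \<in> Fin" "D - e n < d F" and p: "p \<in> \<Inter>F" "norm p < D + e n"
      and r: "r \<in> \<Inter>F" "norm r < D + e n" for p r F n
  proof -
    have "(1/2) *\<^sub>R p + (1/2) *\<^sub>R r \<in> \<Inter>F"
      using p(1) r(1) F(1) convex by (auto simp: Fin_def intro!: convexD)
    then have "d F \<le> norm ((1/2) *\<^sub>R p + (1/2) *\<^sub>R r)"
      by (rule d_le)
    also have "\<dots> = norm (p + r) / 2"
      by (simp flip: scaleR_right_distrib)
    finally have lower: "2 * (D - e n) \<le> norm (p + r)" using F(2) by simp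
    have par: "(norm (p - r))\<^sup>2 = 2 * (norm p)\<^sup>2 + 2 * (norm r)\<^sup>2 - (norm (p + r))\<^sup>2"
      by (simp add: power2_norm_eq_inner inner_commute algebra_simps)
    have "(norm p)\<^sup>2 \<le> (D + e n)\<^sup>2" "(norm r)\<^sup>2 \<le> (D + e n)\<^sup>2"
      using p(2) r(2) by (auto intro!: power_mono)
    then have upper: "(norm (p - r))\<^sup>2 \<le> 4 * (D + e n)\<^sup>2 - (norm (p + r))\<^sup>2"
      using par by linarith
    have "4 * (D + e n)\<^sup>2 - (norm (p + r))\<^sup>2 \<le> 16 * (e n * (D + e n))"
    \<comment> \<open>If \<open>D < e n\<close>, then \<open>D - e n\<close> cannot be squared in \<open>lower\<close>, but both norms are small.\<close>
    proof (cases "D \<ge> e n")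
      case True
      then have "(2 * (D - e n))\<^sup>2 \<le> (norm (p + r))\<^sup>2"
        using lower by (intro power_mono) auto
      moreover have "4 * (D + e n)\<^sup>2 - (2 * (D - e n))\<^sup>2 = 16 * (e n * D)"
        by (simp add: power2_eq_square algebra_simps)
      moreover have "e n * D \<le> e n * (D + e n)"
        using e_pos[of n] by simp
      ultimately show ?thesis by linarith
    next
      case False
      then have "(D + e n)\<^sup>2 \<le> (2 * e n) * (D + e n)"
        using D_nonneg e_pos[of n] by (simp add: power2_eq_square mult_right_mono)
      moreover have "0 \<le> e n * (D + e n)"
        using D_nonneg e_pos[of n] by simp
      ultimately show ?thesis
        using zero_le_power2[of "norm (p + r)"] by linarith
    qed
    also have "\<dots> \<le> 16 * (e n * (D + 1))"
      using e_le[of n] e_pos[of n] by simp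
    finally have "(norm (p - r))\<^sup>2 \<le> 16 * (e n * (D + 1))"
      using upper by linarith
    then have "norm (p - r) \<le> sqrt (16 * (e n * (D + 1)))"
      by (rule real_le_rsqrt)
    then show ?thesis by (simp add: real_sqrt_mult dist_norm)
  qed
  \<comment> \<open>Points coming from different finite families are compared through a near-minimizer of the union.\<close>
  have diam: "dist p q \<le> b n" if pq: "p \<in> K n" "q \<in> K n" for p q n
  proof -
    obtain F where F: "F \<in> Fin" "D - e n < d F" "p \<in> \<Inter>F" "norm p < D + e n"
      using pq(1) unfolding K_def by blast
    obtain G where G: "G \<in> Fin" "D - e n < d G" "q \<in> \<Inter>G" "norm q < D + e n"
      using pq(2) unfolding K_def by blast
    obtain r where r: "r \<in> \<Inter>(F \<union> G)" "norm r < D + e n"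
      using near[OF union[OF F(1) G(1)]] by blast
    have "dist p r \<le> 4 * sqrt (e n * (D + 1))" "dist q r \<le> 4 * sqrt (e n * (D + 1))"
      using half[OF F(1,2,3,4), of r] half[OF G(1,2,3,4), of r] r by auto
    then show ?thesis
      using dist_triangle2[of p q r] by (simp add: b_def)
  qed
  have K_anti: "K m \<subseteq> K n" if "n \<le> m" for m n
  proof
    fix x assume "x \<in> K m"
    then obtain F where "F \<in> Fin" "D - e m < d F" "x \<in> \<Inter>F" "norm x < D + e m"
      unfolding K_def by blast
    moreover from this e_mono[OF that] have "D - e n < d F" "norm x < D + e n"
      by linarith+
    ultimately show "x \<in> K n" unfolding K_def by blast
  qed
  have b_lim: "b \<longlonglongrightarrow> 0"
  proof -
    have "(\<lambda>n. 8 * sqrt (e n * (D + 1))) \<longlonglongrightarrow> 8 * sqrt (0 * (D + 1))"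
      unfolding e_def by (intro tendsto_intros LIMSEQ_inverse_real_of_nat)
    then show ?thesis by (simp add: b_def[abs_def])
  qed
  obtain p where p: "\<And>n. p n \<in> K n"
    using meet[OF Fin_B] by metis
  have "Cauchy p"
  proof (rule metric_CauchyI)
    fix \<epsilon> :: real assume "\<epsilon> > 0"
    then have "\<forall>\<^sub>F n in sequentially. b n < \<epsilon>"
      by (rule order_tendstoD(2)[OF b_lim])
    then obtain N where N: "b N < \<epsilon>"
      by (auto simp: eventually_sequentially)
    show "\<exists>M. \<forall>m\<ge>M. \<forall>n\<ge>M. dist (p m) (p n) < \<epsilon>"
    proof (intro exI allI impI)
      fix m n assume "N \<le> m" "N \<le> n"
      then have "p m \<in> K N" "p n \<in> K N"
        using p K_anti by blast+
      then show "dist (p m) (p n) < \<epsilon>"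
        using diam N by fastforce
    qed
  qed
  then obtain l where l: "p \<longlonglongrightarrow> l"
    using Cauchy_convergent convergent_def by blast
  have "l \<in> A" if A: "A \<in> C" for A
  proof -
    have "{A, B} \<in> Fin" using A B by (auto simp: Fin_def)
    then have "\<forall>n. \<exists>q. q \<in> K n \<and> q \<in> A"
      using meet[of "{A, B}"] by auto
    then obtain q where q: "\<And>n. q n \<in> K n" "\<And>n. q n \<in> A"
      by metis
    have "(\<lambda>n. dist (p n) (q n)) \<longlonglongrightarrow> 0"
      by (rule tendsto_sandwich[OF _ _ tendsto_const b_lim]) (use diam p q in auto)
    then have "(\<lambda>n. p n - q n) \<longlonglongrightarrow> 0"
      by (simp add: dist_norm tendsto_norm_zero_iff)
    then have "q \<longlonglongrightarrow> l"
      using tendsto_diff[OF l, of "\<lambda>n. p n - q n" 0] by simp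
    then show ?thesis
      using closed_sequentially[OF closed[OF A]] q(2) by blast
  qed
  then show ?thesis by blast
qed

text \<open>
  The sublevel sets at values of \<open>g\<close> form a chain of bounded closed convex sets, so they have a
  common point.
\<close>

lemma quasiconvex_attains_min:
  fixes g :: "'a::{real_inner, complete_space} \<Rightarrow> real"
  assumes "closed S" "convex S" "S \<noteq> {}"
    and closed: "\<And>c. closed {x. g x \<le> c}"
    and convex: "\<And>c. convex {x. g x \<le> c}" and bounded: "\<And>c. bounded {x. g x \<le> c}"
  obtains x where "x \<in> S" "\<And>y. y \<in> S \<Longrightarrow> g x \<le> g y"
proof -
  define L where "L c = S \<inter> {x. g x \<le> c}" for c
  obtain s where s: "s \<in> S" using assms(3) by blast
  have "\<Inter>(L ` g ` S) \<noteq> {}"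
  proof (rule closed_convex_finite_intersection)
    show "L (g s) \<in> L ` g ` S" using s by blast
    show "bounded (L (g s))" unfolding L_def using bounded by blast
    show "\<Inter>F \<noteq> {}" if F: "finite F" "F \<subseteq> L ` g ` S" "F \<noteq> {}" for F
    proof -
      obtain T where T: "finite T" "T \<subseteq> S" "F = L ` g ` T"
        using finite_subset_image[OF F(1), of "\<lambda>t. L (g t)" S] F(2) by (auto simp: image_image)
      then have "T \<noteq> {}" using F(3) by auto
      then obtain t where t: "t \<in> T" "\<And>u. u \<in> T \<Longrightarrow> g t \<le> g u"
        using T(1) ex_is_arg_min_if_finite[of T g] by (auto simp: is_arg_min_linorder)
      then have "t \<in> \<Inter>F" using T by (auto simp: L_def)
      then show ?thesis by blast
    qed
  qed (use closed assms(1,2) convex in \<open>auto simp: L_def intro: convex_Int closed_Int\<close>)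
  then obtain x where "\<And>y. y \<in> S \<Longrightarrow> x \<in> L (g y)" by blast
  then show ?thesis using that[of x] s by (auto simp: L_def)
qed

text \<open>
  The vector \<open>w\<close> points from \<open>a\<close> to its nearest point in \<open>S\<close>, which exists in every Hilbert space.
\<close>

lemma separate_point_closed_convex:
  fixes S :: "'a::{real_inner, complete_space} set"
  assumes "closed S" "convex S" "S \<noteq> {}" "a \<notin> S"
  obtains w where "\<And>x. x \<in> S \<Longrightarrow> 0 < inner w (x - a)"
proof -
  have "{x. dist a x \<le> c} = cball a c" for c by auto
  then obtain p where p: "p \<in> S" "\<And>y. y \<in> S \<Longrightarrow> dist a p \<le> dist a y"
    using quasiconvex_attains_min[OF assms(1-3), of "dist a"]
    by (simp add: closed_cball) blast
  have "p \<noteq> a" using p assms(4) by blast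
  have "0 < inner (p - a) (x - a)" if "x \<in> S" for x
  proof -
    have "inner (a - p) (x - p) \<le> 0"
      using any_closest_point_dot[OF assms(2,1) p(1) that] p(2) by blast
    moreover have "inner (p - a) (p - a) > 0" using \<open>p \<noteq> a\<close> by simp
    ultimately show ?thesis by (simp add: algebra_simps inner_commute)
  qed
  then show ?thesis using that[of "p - a"] by simp
qed

section \<open>The Kirszbraun--Valentine theorem\<close>

text \<open>
  The pairwise squared distances of weighted points determine their variance. The second
  term on the right vanishes when the points are measured from their barycenter; from any other
  origin it only lowers the right-hand side.
\<close>

lemma weighted_variance:
  fixes c :: "'i \<Rightarrow> 'a::real_inner"
  assumes "sum p I = 1"
  shows "(\<Sum>i\<in>I. \<Sum>j\<in>I. p i * p j * (norm (c i - c j))\<^sup>2) =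
    2 * (\<Sum>i\<in>I. p i * (norm (c i))\<^sup>2) - 2 * (norm (\<Sum>i\<in>I. p i *\<^sub>R c i))\<^sup>2"
proof -
  have "(\<Sum>i\<in>I. \<Sum>j\<in>I. p i * p j * (norm (c i - c j))\<^sup>2) =
      (\<Sum>i\<in>I. \<Sum>j\<in>I. (p i * (norm (c i))\<^sup>2) * p j + p i * (p j * (norm (c j))\<^sup>2)
         - 2 * inner (p i *\<^sub>R c i) (p j *\<^sub>R c j))"
    by (intro sum.cong refl) (simp add: power2_norm_eq_inner algebra_simps inner_commute)
  also have "\<dots> = (\<Sum>i\<in>I. p i * (norm (c i))\<^sup>2) * sum p I + sum p I * (\<Sum>i\<in>I. p i * (norm (c i))\<^sup>2)
      - 2 * (\<Sum>i\<in>I. \<Sum>j\<in>I. inner (p i *\<^sub>R c i) (p j *\<^sub>R c j))"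
    by (simp only: sum.distrib sum_subtractf sum_product) (simp only: sum_distrib_left)
  also have "(\<Sum>i\<in>I. \<Sum>j\<in>I. inner (p i *\<^sub>R c i) (p j *\<^sub>R c j)) =
      inner (\<Sum>i\<in>I. p i *\<^sub>R c i) (\<Sum>i\<in>I. p i *\<^sub>R c i)"
    by (subst inner_sum_left, subst inner_sum_right) (rule refl)
  finally show ?thesis
    using assms by (simp add: power2_norm_eq_inner)
qed

text \<open>
  Both sides are compared with half the weighted sum of the pairwise squared distances: equality
  holds on the left because \<open>y\<close> is the barycenter, and an inequality on the right for arbitrary \<open>x\<close>.
  This is the only place where the distances in the two spaces are compared.
\<close>

lemma barycenter_inequality:
  fixes a :: "'i \<Rightarrow> 'a::real_inner" and b :: "'i \<Rightarrow> 'b::real_inner"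
  assumes p: "sum p I = 1" "\<And>i. i \<in> I \<Longrightarrow> 0 \<le> p i"
    and le: "\<And>i j. i \<in> I \<Longrightarrow> j \<in> I \<Longrightarrow> dist (b i) (b j) \<le> dist (a i) (a j)"
    and y: "y = (\<Sum>i\<in>I. p i *\<^sub>R b i)"
  shows "(\<Sum>i\<in>I. p i * (dist y (b i))\<^sup>2) \<le> (\<Sum>i\<in>I. p i * (dist x (a i))\<^sup>2)"
proof -
  have "(\<Sum>i\<in>I. p i *\<^sub>R (b i - y)) = 0"
    using p(1) by (simp add: scaleR_diff_right sum_subtractf y flip: scaleR_sum_left)
  then have "2 * (\<Sum>i\<in>I. p i * (norm (b i - y))\<^sup>2) =
      (\<Sum>i\<in>I. \<Sum>j\<in>I. p i * p j * (dist (b i) (b j))\<^sup>2)"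
    using weighted_variance[OF p(1), of "\<lambda>i. b i - y"] by (simp add: dist_norm)
  also have "\<dots> \<le> (\<Sum>i\<in>I. \<Sum>j\<in>I. p i * p j * (dist (a i) (a j))\<^sup>2)"
    using p(2) le by (intro sum_mono mult_left_mono power_mono mult_nonneg_nonneg) auto
  also have "\<dots> \<le> 2 * (\<Sum>i\<in>I. p i * (norm (a i - x))\<^sup>2)"
    using weighted_variance[OF p(1), of "\<lambda>i. a i - x"] by (simp add: dist_norm)
  finally show ?thesis by (simp add: dist_norm norm_minus_commute)
qed

lemma decrease_toward:
  fixes y w :: "'a::real_inner"
  assumes "0 < inner w (b - y)"
  shows "\<forall>\<^sub>F t in at_right 0. (dist (y + t *\<^sub>R w) b)\<^sup>2 < (dist y b)\<^sup>2"
proof -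
  have "((\<lambda>t. t * (norm w)\<^sup>2) \<longlongrightarrow> 0 * (norm w)\<^sup>2) (at_right 0)"
    by (intro tendsto_intros)
  then have "\<forall>\<^sub>F t in at_right 0. t * (norm w)\<^sup>2 < 2 * inner w (b - y)"
    by (rule order_tendstoD(2)) (use assms in simp)
  moreover have "\<forall>\<^sub>F t in at_right (0::real). 0 < t"
    by (simp add: eventually_at_right_less)
  ultimately show ?thesis
  proof eventually_elim
    case (elim t)
    have "(dist (y + t *\<^sub>R w) b)\<^sup>2 = (dist y b)\<^sup>2 + t * (t * (norm w)\<^sup>2 - 2 * inner w (b - y))"
      by (simp add: dist_norm power2_norm_eq_inner algebra_simps inner_commute)
    moreover have "t * (t * (norm w)\<^sup>2 - 2 * inner w (b - y)) < 0"
      using elim by (simp add: mult_less_0_iff)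
    ultimately show ?case by linarith
  qed
qed

text \<open>
  Partial 1-Lipschitz maps are treated as their graphs, so that extending a map is set inclusion.
  Single-valuedness is the case of distance 0.
\<close>

definition short_relation :: "('a::metric_space \<times> 'b::metric_space) set \<Rightarrow> bool" where
  "short_relation G \<longleftrightarrow> (\<forall>(x, y)\<in>G. \<forall>(x', y')\<in>G. dist y y' \<le> dist x x')"

lemma short_relationD:
  "short_relation G \<Longrightarrow> (x, y) \<in> G \<Longrightarrow> (x', y') \<in> G \<Longrightarrow> dist y y' \<le> dist x x'"
  unfolding short_relation_def by fast

lemma short_relation_subset: "short_relation G \<Longrightarrow> H \<subseteq> G \<Longrightarrow> short_relation H"
  unfolding short_relation_def by fast

text \<open>
  The point \<open>y\<close> minimizes the largest excess \<open>h y q\<close> of a squared distance over the allowed one. At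
  a minimizer, \<open>y\<close> lies in the convex hull of the second components \<open>b\<close> of those pairs where the
  largest excess is attained; otherwise moving \<open>y\<close> slightly along a direction separating it from
  the hull would decrease all of the largest excesses at once. With the convex weights,
  \<open>barycenter_inequality\<close> shows that the average of these equal excesses is not positive.
\<close>

lemma short_relation_finite_point:
  fixes G :: "('a::real_inner \<times> 'b::{real_inner, complete_space}) set"
  assumes fin: "finite G" "G \<noteq> {}" and short: "short_relation G"
  obtains y where "\<And>a b. (a, b) \<in> G \<Longrightarrow> dist y b \<le> dist x a"
proof -
  define h where "h y q = (dist y (snd q))\<^sup>2 - (dist x (fst q))\<^sup>2" for y and q :: "'a \<times> 'b"
  define g where "g y = (MAX q\<in>G. h y q)" for y
  have g_le: "g y \<le> c \<longleftrightarrow> (\<forall>q\<in>G. h y q \<le> c)" for y c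
    using fin by (simp add: g_def)
  have h_le: "h y q \<le> c \<longleftrightarrow> 0 \<le> c + (dist x (fst q))\<^sup>2 \<and> y \<in> cball (snd q) (sqrt (c + (dist x (fst q))\<^sup>2))"
    for y q c
  proof -
    have "h y q \<le> c \<longleftrightarrow> (dist y (snd q))\<^sup>2 \<le> c + (dist x (fst q))\<^sup>2"
      by (auto simp: h_def)
    also have "\<dots> \<longleftrightarrow> 0 \<le> c + (dist x (fst q))\<^sup>2 \<and> dist y (snd q) \<le> sqrt (c + (dist x (fst q))\<^sup>2)"
      (is "?d\<^sup>2 \<le> ?c \<longleftrightarrow> _")
    proof (intro iffI conjI)
      show "0 \<le> ?c" if "?d\<^sup>2 \<le> ?c"
        using order_trans[OF zero_le_power2 that] .
      show "?d \<le> sqrt ?c" if "?d\<^sup>2 \<le> ?c"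
        using that by (rule real_le_rsqrt)
      show "?d\<^sup>2 \<le> ?c" if "0 \<le> ?c \<and> ?d \<le> sqrt ?c"
        using that power_mono[of ?d "sqrt ?c" 2] by simp
    qed
    finally show ?thesis by (simp add: dist_commute)
  qed
  have sub: "closed {y. h y q \<le> c}" "convex {y. h y q \<le> c}" "bounded {y. h y q \<le> c}" for q c
  proof -
    have "{y. h y q \<le> c} = {} \<or> {y. h y q \<le> c} = cball (snd q) (sqrt (c + (dist x (fst q))\<^sup>2))"
      by (auto simp only: h_le)
    then show "closed {y. h y q \<le> c}" "convex {y. h y q \<le> c}" "bounded {y. h y q \<le> c}" by auto
  qed
  obtain q0 where q0: "q0 \<in> G" using fin(2) by blast
  have sublevel: "{y. g y \<le> c} = (\<Inter>q\<in>G. {y. h y q \<le> c})" for c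
    by (auto simp: g_le)
  obtain y where y: "\<And>z. g y \<le> g z"
  proof (rule quasiconvex_attains_min[of UNIV g])
    show "closed {y. g y \<le> c}" "convex {y. g y \<le> c}" for c
      unfolding sublevel by (intro closed_INT convex_INT ballI sub)+
    show "bounded {y. g y \<le> c}" for c
      using q0 g_le by (intro bounded_subset[OF sub(3)[of q0 c]]) blast
  qed auto
  have "g y \<le> 0"
  proof (rule ccontr)
    assume pos: "\<not> g y \<le> 0"
    \<comment> \<open>\<open>A\<close> collects the active constraints, \<open>V\<close> the centers of the corresponding balls.\<close>
    define A where "A = {q\<in>G. h y q = g y}"
    define V where "V = snd ` A"
    have "finite A" "A \<subseteq> G" using fin by (auto simp: A_def)
    then have "finite V" by (simp add: V_def)
    have h_upper: "h y q \<le> g y" if "q \<in> G" for q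
      using g_le[of y "g y"] that by blast
    have "g y \<in> h y ` G"
      unfolding g_def using fin by (intro Max_in) auto
    then obtain q where "q \<in> G" "h y q = g y" by (metis imageE)
    then have "A \<noteq> {}" unfolding A_def by blast
    have "y \<in> convex hull V"
    proof (rule ccontr)
      assume "y \<notin> convex hull V"
      moreover have "convex hull V \<noteq> {}" using \<open>A \<noteq> {}\<close> by (simp add: V_def)
      moreover have "closed (convex hull V)"
        using \<open>finite V\<close> by (intro compact_imp_closed finite_imp_compact_convex_hull)
      ultimately obtain w where w: "\<And>v. v \<in> convex hull V \<Longrightarrow> 0 < inner w (v - y)"
        using separate_point_closed_convex[of "convex hull V" y] convex_convex_hull by blast
      have "\<forall>\<^sub>F t in at_right 0. h (y + t *\<^sub>R w) q < g y" if q: "q \<in> G" for q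
      proof (cases "q \<in> A")
        case True
        then have "0 < inner w (snd q - y)"
          by (intro w hull_inc) (simp add: V_def)
        from decrease_toward[OF this] show ?thesis
        proof eventually_elim
          case (elim t)
          then show ?case using True by (simp add: A_def h_def)
        qed
      next
        case False
        have "((\<lambda>t. h (y + t *\<^sub>R w) q) \<longlongrightarrow> h (y + 0 *\<^sub>R w) q) (at_right 0)"
          unfolding h_def by (intro tendsto_intros)
        moreover have "h (y + 0 *\<^sub>R w) q < g y"
          using False q h_upper[OF q] by (simp add: A_def)
        ultimately show ?thesis by (rule order_tendstoD(2))
      qed
      then have "\<forall>\<^sub>F t in at_right 0. \<forall>q\<in>G. h (y + t *\<^sub>R w) q < g y"
        using fin by (intro eventually_ball_finite) auto
      then obtain t where "\<forall>q\<in>G. h (y + t *\<^sub>R w) q < g y"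
        using eventually_happens'[of "at_right (0::real)"] by auto
      then have "g (y + t *\<^sub>R w) < g y"
        using fin by (subst g_def) (simp add: Max_less_iff)
      then show False using y[of "y + t *\<^sub>R w"] by linarith
    qed
    then obtain p where p: "\<And>v. v \<in> V \<Longrightarrow> 0 \<le> p v" "sum p V = 1" "(\<Sum>v\<in>V. p v *\<^sub>R v) = y"
      using \<open>finite V\<close> by (auto simp: convex_hull_finite)
    have "\<forall>v\<in>V. \<exists>a. (a, v) \<in> A" by (force simp: V_def)
    then obtain a where a: "\<And>v. v \<in> V \<Longrightarrow> (a v, v) \<in> A" by metis
    have "(\<Sum>v\<in>V. p v * (dist y v)\<^sup>2) \<le> (\<Sum>v\<in>V. p v * (dist x (a v))\<^sup>2)"
    proof (rule barycenter_inequality)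
      show "dist u v \<le> dist (a u) (a v)" if "u \<in> V" "v \<in> V" for u v
        using short_relationD[OF short, of "a u" u "a v" v] a[OF that(1)] a[OF that(2)] by (simp add: A_def)
    qed (use p in auto)
    moreover have "(\<Sum>v\<in>V. p v * (dist y v)\<^sup>2) - (\<Sum>v\<in>V. p v * (dist x (a v))\<^sup>2) = g y"
    proof -
      have "(dist y v)\<^sup>2 - (dist x (a v))\<^sup>2 = g y" if "v \<in> V" for v
        using a[OF that] by (simp add: A_def h_def)
      then have "(\<Sum>v\<in>V. p v * ((dist y v)\<^sup>2 - (dist x (a v))\<^sup>2)) = (\<Sum>v\<in>V. p v * g y)"
        by (intro sum.cong) auto
      then show ?thesis
        using p(2) by (simp add: right_diff_distrib sum_subtractf flip: sum_distrib_right)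
    qed
    ultimately show False using pos by linarith
  qed
  then have "dist y b \<le> dist x a" if "(a, b) \<in> G" for a b
    using g_le[of y 0] that by (force simp: h_def intro: power2_le_imp_le)
  then show ?thesis by (rule that)
qed

text \<open>
  The required \<open>y\<close> is a common point of closed balls, of which finitely many meet by the previous
  lemma.
\<close>

lemma short_relation_point:
  fixes G :: "('a::real_inner \<times> 'b::{real_inner, complete_space}) set"
  assumes short: "short_relation G"
  obtains y where "\<And>a b. (a, b) \<in> G \<Longrightarrow> dist y b \<le> dist x a"
proof (cases "G = {}")
  case False
  define ball_at where "ball_at q = cball (snd q) (dist x (fst q))" for q :: "'a \<times> 'b"
  have "\<Inter>(ball_at ` G) \<noteq> {}"
  proof -
    obtain q where q: "q \<in> G" using False by blast
    show ?thesis
    proof (rule closed_convex_finite_intersection)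
      show "ball_at q \<in> ball_at ` G" using q by blast
      show "\<Inter>F \<noteq> {}" if F: "finite F" "F \<subseteq> ball_at ` G" "F \<noteq> {}" for F
      proof -
        obtain H where H: "H \<subseteq> G" "finite H" "F = ball_at ` H"
          using finite_subset_image[OF F(1,2)] by blast
        then have "H \<noteq> {}" using F(3) by blast
        moreover have "short_relation H"
          by (rule short_relation_subset[OF short H(1)])
        ultimately obtain y where "\<And>a b. (a, b) \<in> H \<Longrightarrow> dist y b \<le> dist x a"
          using short_relation_finite_point[OF H(2)] by blast
        then have "y \<in> \<Inter>F"
          by (auto simp: H(3) ball_at_def dist_commute)
        then show ?thesis by blast
      qed
    qed (auto simp: ball_at_def)
  qed
  then obtain y where "\<And>q. q \<in> G \<Longrightarrow> y \<in> ball_at q" by blast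
  then show ?thesis
    using that[of y] by (force simp: ball_at_def dist_commute)
qed (use that in blast)

text \<open>
  The Kirszbraun--Valentine theorem, in arbitrary dimension: a maximal short relation containing
  the graph of \<open>f\<close> has full domain, since otherwise \<open>short_relation_point\<close> would enlarge it.
\<close>

theorem kirszbraun:
  fixes f :: "'a::real_inner \<Rightarrow> 'b::{real_inner, complete_space}"
  assumes "1-lipschitz_on S f"
  obtains F where "1-lipschitz_on UNIV F" "\<And>x. x \<in> S \<Longrightarrow> F x = f x"
proof -
  define graph where "graph = (\<lambda>x. (x, f x)) ` S"
  define E where "E = {G. graph \<subseteq> G \<and> short_relation G}"
  have "graph \<in> E"
    using assms by (auto simp: E_def graph_def short_relation_def lipschitz_on_def)
  have "\<exists>M\<in>E. \<forall>G\<in>E. M \<subseteq> G \<longrightarrow> G = M"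
  proof (rule subset_Zorn_nonempty)
    show "E \<noteq> {}" using \<open>graph \<in> E\<close> by blast
    show "\<Union>\<C> \<in> E" if C: "\<C> \<noteq> {}" "subset.chain E \<C>" for \<C>
    proof -
      have "dist y y' \<le> dist x x'" if "(x, y) \<in> G" "G \<in> \<C>" "(x', y') \<in> G'" "G' \<in> \<C>" for x y x' y' G G'
      proof -
        have "G \<subseteq> G' \<or> G' \<subseteq> G"
          using C(2) that unfolding subset.chain_def by blast
        moreover have "short_relation G" "short_relation G'"
          using C(2) that by (auto simp: subset.chain_def E_def)
        ultimately show ?thesis using that short_relationD by (metis subsetD)
      qed
      then have "short_relation (\<Union>\<C>)" unfolding short_relation_def by fast
      moreover have "graph \<subseteq> \<Union>\<C>"
        using C by (force simp: subset.chain_def E_def)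
      ultimately show ?thesis by (simp add: E_def)
    qed
  qed
  then obtain M where M: "M \<in> E" "\<And>G. G \<in> E \<Longrightarrow> M \<subseteq> G \<Longrightarrow> G = M" by blast
  have short: "dist y y' \<le> dist x x'" if "(x, y) \<in> M" "(x', y') \<in> M" for x y x' y'
    using M(1) that short_relationD by (auto simp: E_def)
  have "\<exists>y. (x, y) \<in> M" for x
  proof -
    obtain y where y: "\<And>a b. (a, b) \<in> M \<Longrightarrow> dist y b \<le> dist x a"
      using short_relation_point[of M x] M(1) by (auto simp: E_def)
    have "short_relation (insert (x, y) M)"
      unfolding short_relation_def using short y y[unfolded dist_commute[of y] dist_commute[of x]]
      by fastforce
    then have "insert (x, y) M = M"
      using M(1) by (intro M(2)) (auto simp: E_def)
    then show ?thesis by blast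
  qed
  then obtain F where F: "\<And>x. (x, F x) \<in> M" by metis
  show ?thesis
  proof
    show "1-lipschitz_on UNIV F"
      using short F by (auto simp: lipschitz_on_def)
    show "F x = f x" if "x \<in> S" for x
    proof -
      have "(x, f x) \<in> M"
        using M(1) that by (auto simp: E_def graph_def)
      from short[OF F[of x] this] show ?thesis by simp
    qed
  qed
qed

section \<open>Cones of vector orders\<close>

lemma vector_orderD:
  assumes "vector_order r"
  shows vector_order_refl: "(x, x) \<in> r"
    and vector_order_antisym: "(x, y) \<in> r \<Longrightarrow> (y, x) \<in> r \<Longrightarrow> x = y"
    and vector_order_trans: "(x, y) \<in> r \<Longrightarrow> (y, z) \<in> r \<Longrightarrow> (x, z) \<in> r"
    and vector_order_scale: "0 \<le> c \<Longrightarrow> (x, y) \<in> r \<Longrightarrow> (c *\<^sub>R x, c *\<^sub>R y) \<in> r"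
    and vector_order_add: "(x, y) \<in> r \<Longrightarrow> (x + z, y + z) \<in> r"
  using assms
  by (auto simp: vector_order_def partial_order_on_def preorder_on_def refl_on_def
      dest: antisymD transD)

definition positive_cone :: "('a::real_vector \<times> 'a) set \<Rightarrow> 'a set" where
  "positive_cone r = {x. (x, 0) \<in> r}"

context
  fixes r :: "('a::real_vector \<times> 'a) set"
  assumes r: "vector_order r"
begin

lemma positive_cone_iff: "(x, y) \<in> r \<longleftrightarrow> x - y \<in> positive_cone r"
  using vector_order_add[OF r, of x y "- y"] vector_order_add[OF r, of "x - y" 0 y]
  by (auto simp: positive_cone_def)

lemma positive_cone_uminus: "(0, x) \<in> r \<longleftrightarrow> - x \<in> positive_cone r"
  by (simp add: positive_cone_iff)

lemma zero_in_positive_cone: "0 \<in> positive_cone r"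
  using vector_order_refl[OF r] by (simp add: positive_cone_def)

lemma positive_cone_scale: "0 \<le> c \<Longrightarrow> x \<in> positive_cone r \<Longrightarrow> c *\<^sub>R x \<in> positive_cone r"
  using vector_order_scale[OF r, of c x 0] by (simp add: positive_cone_def)

lemma positive_cone_add:
  assumes "x \<in> positive_cone r" "y \<in> positive_cone r"
  shows "x + y \<in> positive_cone r"
proof -
  have "(x + y, y) \<in> r" "(y, 0) \<in> r"
    using assms by (simp_all add: positive_cone_iff)
  then show ?thesis
    using vector_order_trans[OF r, of "x + y" y 0] by (simp add: positive_cone_def)
qed

lemma positive_cone_pointed: "x \<in> positive_cone r \<Longrightarrow> - x \<in> positive_cone r \<Longrightarrow> x = 0"
  using vector_order_antisym[OF r, of x 0] positive_cone_uminus[of x] by (simp add: positive_cone_def)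

lemma convex_positive_cone: "convex (positive_cone r)"
  by (intro convexI positive_cone_add positive_cone_scale) auto

lemma vector_order_Id_iff: "r = Id \<longleftrightarrow> positive_cone r \<subseteq> {0}"
proof
  assume "positive_cone r \<subseteq> {0}"
  then have "(x, y) \<in> r \<longleftrightarrow> x = y" for x y
    using zero_in_positive_cone positive_cone_iff[of x y] by auto
  then show "r = Id" by auto
qed (auto simp: positive_cone_def)

lemma vector_order_total_iff: "total r \<longleftrightarrow> (\<forall>x. x \<in> positive_cone r \<or> - x \<in> positive_cone r)"
proof
  assume "total r"
  then show "\<forall>x. x \<in> positive_cone r \<or> - x \<in> positive_cone r"
    using positive_cone_uminus zero_in_positive_cone
    unfolding total_on_def positive_cone_def by (metis UNIV_I mem_Collect_eq)
next
  assume *: "\<forall>x. x \<in> positive_cone r \<or> - x \<in> positive_cone r"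
  have "(x, y) \<in> r \<or> (y, x) \<in> r" for x y
    using *[rule_format, of "x - y"] by (simp add: positive_cone_iff)
  then show "total r" by (auto simp: total_on_def)
qed

end

lemma closed_positive_cone:
  fixes r :: "('a::real_normed_vector \<times> 'a) set"
  assumes "closed r"
  shows "closed (positive_cone r)"
proof -
  have "positive_cone r = (\<lambda>x. (x, 0)) -` r" by (auto simp: positive_cone_def)
  then show ?thesis
    using assms by (auto intro!: closed_vimage continuous_intros)
qed

text \<open>
  If an incomparable \<open>b\<close> is orthogonal to all positive vectors, then \<open>b + u\<close> is a replacement: it is
  not orthogonal to \<open>u\<close>, and it is incomparable to 0 because it is not orthogonal to \<open>b\<close>.
\<close>

lemma incomparable_not_orthogonal:
  fixes r :: "('a::real_inner \<times> 'a) set"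
  assumes r: "vector_order r" and "\<not> total r" and u: "u \<in> positive_cone r" "u \<noteq> 0"
  obtains a v where "a \<notin> positive_cone r" "- a \<notin> positive_cone r"
    "v \<in> positive_cone r" "0 < inner a v"
proof -
  let ?P = "positive_cone r"
  obtain b where b: "b \<notin> ?P" "- b \<notin> ?P"
    using assms(2) vector_order_total_iff[OF r] by auto
  have "\<exists>a v. a \<notin> ?P \<and> - a \<notin> ?P \<and> v \<in> ?P \<and> inner a v \<noteq> 0"
  proof (cases "\<exists>v\<in>?P. inner b v \<noteq> 0")
    case True
    then show ?thesis using b by blast
  next
    case False
    then have orth: "inner b v = 0" if "v \<in> ?P" for v using that by blast
    have "b \<noteq> 0" using b zero_in_positive_cone[OF r] by blast
    then have "inner b (b + u) \<noteq> 0"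
      using orth[OF u(1)] by (simp add: inner_add_right)
    then have "inner b (b + u) \<noteq> 0" "inner b (- (b + u)) \<noteq> 0"
      unfolding inner_minus_right by simp_all
    then have "b + u \<notin> ?P" "- (b + u) \<notin> ?P" using orth by blast+
    moreover have "inner (b + u) u \<noteq> 0"
      using orth[OF u(1)] u(2) by (simp add: inner_add_left)
    ultimately show ?thesis using u(1) by blast
  qed
  then obtain a v where "a \<notin> ?P" "- a \<notin> ?P" "v \<in> ?P" "inner a v \<noteq> 0" by blast
  then show ?thesis
    using that[of a v] that[of "- a" v] by (cases "0 < inner a v") auto
qed

text \<open>
  Otherwise the cone would be closed. In dimension at least two, nonzero vectors \<open>x\<close> in the cone and
  \<open>y\<close> in its negative can be joined by a segment that avoids 0, and the cone and its negative would
  split this connected segment into two disjoint nonempty closed parts. In the lexicographic plane,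
  \<open>u\<close> is a vector on the boundary line.
\<close>

lemma total_order_not_closed_pointed:
  fixes r :: "('a::real_inner \<times> 'a) set"
  assumes r: "vector_order r" and "total r" and dim: "\<exists>B::'a set. independent B \<and> card B = 2"
  obtains u where "u \<in> positive_cone r" "u \<noteq> 0" "- u \<in> closure (positive_cone r)"
proof -
  let ?P = "positive_cone r"
  have total: "x \<in> ?P \<or> - x \<in> ?P" for x
    using assms(2) vector_order_total_iff[OF r] by blast
  have False if none: "\<And>u. u \<in> ?P \<Longrightarrow> u \<noteq> 0 \<Longrightarrow> - u \<notin> closure ?P"
  proof -
    have "x \<in> ?P" if x: "x \<in> closure ?P" for x
      using total[of x] none[of "- x"] x zero_in_positive_cone[OF r] by fastforce
    then have closed: "closed ?P"
      using closure_subset[of ?P] by (metis closed_closure subsetI subset_antisym)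
    obtain b c :: 'a where bc: "independent {b, c}" "b \<noteq> c"
      using dim by (metis card_2_iff)
    have nz: "s *\<^sub>R b + t *\<^sub>R c \<noteq> 0" if "s \<noteq> 0 \<or> t \<noteq> 0" for s t
    proof
      assume eq: "s *\<^sub>R b + t *\<^sub>R c = 0"
      have "(\<Sum>v\<in>{b, c}. (if v = b then s else t) *\<^sub>R v) = 0"
        using bc(2) eq by auto
      then have "(if v = b then s else t) = 0" if "v \<in> {b, c}" for v
        using independentD[OF bc(1) _ order_refl _ that, of "\<lambda>v. if v = b then s else t"] by simp
      from this[of b] this[of c] show False using that bc(2) by auto
    qed
    \<comment> \<open>Neither sign of \<open>b\<close> and \<open>c\<close> is known, so four segments are needed below.\<close>
    have sep: False if xP: "x \<in> ?P" and y: "- y \<in> ?P" and seg: "0 \<notin> closed_segment x y" for x y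
    proof -
      have "closed (uminus ` ?P)" by (rule closed_negations[OF closed])
      moreover have "closed_segment x y \<subseteq> ?P \<union> uminus ` ?P"
        using total by (metis UnCI image_eqI minus_minus subsetI)
      moreover have "?P \<inter> uminus ` ?P \<inter> closed_segment x y = {}"
      proof -
        have "z = 0" if "z \<in> ?P" "z \<in> uminus ` ?P" for z
          using that by (intro positive_cone_pointed[OF r]) auto
        then show ?thesis using seg by (metis IntE equals0I)
      qed
      moreover have "x \<in> ?P \<inter> closed_segment x y" "y \<in> uminus ` ?P \<inter> closed_segment x y"
        using xP image_eqI[OF _ y, of y uminus] by simp_all
      ultimately show False
        using connected_segment[of x y] closed unfolding connected_closed by (metis empty_iff)
    qed
    have seg: "0 \<notin> closed_segment (\<sigma> *\<^sub>R b) (\<tau> *\<^sub>R c)" if "\<sigma> \<noteq> 0" "\<tau> \<noteq> 0" for \<sigma> \<tau>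
    proof
      assume "0 \<in> closed_segment (\<sigma> *\<^sub>R b) (\<tau> *\<^sub>R c)"
      then obtain t where "((1 - t) * \<sigma>) *\<^sub>R b + (t * \<tau>) *\<^sub>R c = 0"
        by (auto simp: in_segment)
      then have "(1 - t) * \<sigma> = 0" "t * \<tau> = 0" using nz by blast+
      then show False using that by auto
    qed
    show False
      using total[of b] total[of c] sep[of b c] sep[of b "- c"] sep[of "- b" c] sep[of "- b" "- c"]
        seg[of 1 1] seg[of 1 "- 1"] seg[of "- 1" 1] seg[of "- 1" "- 1"] by auto
  qed
  then show ?thesis using that by blast
qed

section \<open>Nontrivial orders obstruct extension\<close>

text \<open>
  The functional separating a point outside \<open>Q\<close> from \<open>Q\<close> is nonnegative on \<open>Q\<close>, since a negative
  value could be scaled to reach the separating level.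
\<close>

lemma dual_cone_nonzero:
  fixes Q :: "'a::{real_inner, complete_space} set"
  assumes "closed Q" "convex Q" and zero: "0 \<in> Q" and scale: "\<And>c q. 0 \<le> c \<Longrightarrow> q \<in> Q \<Longrightarrow> c *\<^sub>R q \<in> Q"
    and "Q \<noteq> UNIV"
  obtains w where "norm w = 1" "\<And>q. q \<in> Q \<Longrightarrow> 0 \<le> inner w q"
proof -
  obtain a where a: "a \<notin> Q" using assms(5) by blast
  obtain w where w: "\<And>q. q \<in> Q \<Longrightarrow> 0 < inner w (q - a)"
    using separate_point_closed_convex[OF assms(1,2) _ a] zero by blast
  have wa: "inner w a < 0" using w[OF zero] by simp
  then have "w \<noteq> 0" by auto
  have nonneg: "0 \<le> inner w q" if "q \<in> Q" for q
  proof (rule ccontr)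
    assume neg: "\<not> 0 \<le> inner w q"
    define t where "t = inner w a / inner w q"
    have "0 \<le> t" using neg wa by (simp add: t_def divide_nonpos_nonpos)
    from w[OF scale[OF this that]] show False
      using neg by (simp add: inner_diff_right t_def)
  qed
  show ?thesis
  proof
    show "norm (w /\<^sub>R norm w) = 1" using \<open>w \<noteq> 0\<close> by simp
    show "0 \<le> inner (w /\<^sub>R norm w) q" if "q \<in> Q" for q
      using nonneg[OF that] by simp
  qed
qed

text \<open>
  Every failure of the extension property below is already visible on a two-point domain.
\<close>

lemma extension_from_two_points:
  assumes "monotone_lipschitz_extension_property r s" "\<And>x. (x, x) \<in> s"
    and "(a, b) \<in> r \<Longrightarrow> (u, v) \<in> s" "(b, a) \<in> r \<Longrightarrow> (v, u) \<in> s"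
    and "a \<noteq> b" "dist u v \<le> dist a b"
  obtains F where "order_preserving_on UNIV r s F" "1-lipschitz_on UNIV F" "F a = u" "F b = v"
proof -
  define f where "f x = (if x = a then u else v)" for x
  have "f a = u" "f b = v" using assms(5) by (auto simp: f_def)
  then have "order_preserving_on {a, b} r s f"
    using assms(2-4) by (simp add: order_preserving_on_def)
  moreover have "1-lipschitz_on {a, b} f"
    using assms(6) \<open>f a = u\<close> \<open>f b = v\<close>
    by (simp add: lipschitz_on_def) (simp add: dist_commute)
  ultimately obtain F where "order_preserving_on UNIV r s F" "1-lipschitz_on UNIV F" "\<forall>x\<in>{a, b}. F x = f x"
    using assms(1)[unfolded monotone_lipschitz_extension_property_def, rule_format, of "{a, b}" f] by blast
  then show ?thesis using that \<open>f a = u\<close> \<open>f b = v\<close> by simp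
qed

text \<open>
  The map on \<open>{0, a}\<close> that sends 0 to 0 and \<open>a\<close> to \<open>- norm a *\<^sub>R w\<close> with \<open>w\<close> in the dual cone is an isometry and
  has no order constraint. As \<open>inner a v > 0\<close>, some positive multiple \<open>t *\<^sub>R v\<close> is closer to \<open>a\<close> than 0
  is. An extension sends it into the positive cone, whose points are all at distance at least
  \<open>norm a\<close> from the image of \<open>a\<close>.
\<close>

lemma no_extension_nontotal:
  fixes r :: "('a::real_inner \<times> 'a) set" and s :: "('b::{real_inner, complete_space} \<times> 'b) set"
  assumes r: "vector_order r" "r \<noteq> Id" "\<not> total r"
    and s: "hilbert_poset s" and nonzero: "\<exists>y::'b. y \<noteq> 0"
  shows "\<not> monotone_lipschitz_extension_property r s"
proof
  assume ext: "monotone_lipschitz_extension_property r s"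
  let ?Q = "positive_cone s"
  have s': "vector_order s" "closed s" using s by (auto simp: hilbert_poset_def)
  obtain u where "u \<in> positive_cone r" "u \<noteq> 0"
    using vector_order_Id_iff[OF r(1)] r(2) by blast
  then obtain a v where a: "a \<notin> positive_cone r" "- a \<notin> positive_cone r"
    and v: "v \<in> positive_cone r" "0 < inner a v"
    using incomparable_not_orthogonal[OF r(1,3)] by blast
  have "?Q \<noteq> UNIV"
    using nonzero positive_cone_pointed[OF s'(1)] by auto
  then obtain w where w: "norm w = 1" "\<And>q. q \<in> ?Q \<Longrightarrow> 0 \<le> inner w q"
    using dual_cone_nonzero[OF closed_positive_cone[OF s'(2)] convex_positive_cone[OF s'(1)]]
      zero_in_positive_cone[OF s'(1)] positive_cone_scale[OF s'(1)] by blast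
  obtain F where F: "order_preserving_on UNIV r s F" "1-lipschitz_on UNIV F"
    "F 0 = 0" "F a = - norm a *\<^sub>R w"
  proof (rule extension_from_two_points[OF ext])
    show "(x, x) \<in> s" for x by (rule vector_order_refl[OF s'(1)])
    show "0 \<noteq> a" using a(1) zero_in_positive_cone[OF r(1)] by blast
    show "(0, - norm a *\<^sub>R w) \<in> s" if "(0, a) \<in> r"
      using that a by (simp add: positive_cone_uminus[OF r(1)])
    show "(- norm a *\<^sub>R w, 0) \<in> s" if "(a, 0) \<in> r"
      using that a by (simp add: positive_cone_def)
    show "dist 0 (- norm a *\<^sub>R w) \<le> dist 0 a" using w(1) by simp
  qed
  \<comment> \<open>\<open>t *\<^sub>R v\<close> is the orthogonal projection of \<open>a\<close> onto the line through \<open>v\<close>.\<close>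
  define t where "t = inner a v / inner v v"
  have "v \<noteq> 0" using v(2) by auto
  then have t: "t * inner v v = inner a v" "0 < t" using v(2) by (auto simp: t_def)
  then have "(norm (t *\<^sub>R v - a))\<^sup>2 = (norm a)\<^sup>2 - t * inner a v"
    by (simp add: power2_norm_eq_inner algebra_simps inner_commute)
  also have "\<dots> < (norm a)\<^sup>2" using t(2) v(2) by simp
  finally have closer: "norm (t *\<^sub>R v - a) < norm a"
    by (simp add: power2_less_imp_less)
  have "(t *\<^sub>R v, 0) \<in> r"
    using positive_cone_scale[OF r(1) _ v(1), of t] t(2) by (simp add: positive_cone_def)
  then have "F (t *\<^sub>R v) \<in> ?Q"
    using F(1,3) by (force simp: order_preserving_on_def positive_cone_def)
  then have "norm a \<le> inner w (F (t *\<^sub>R v) - F a)"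
    using w by (simp add: F(4) inner_add_right dot_square_norm)
  also have "\<dots> \<le> norm (F (t *\<^sub>R v) - F a)"
    using norm_cauchy_schwarz[of w] w(1) by simp
  also have "\<dots> \<le> norm (t *\<^sub>R v - a)"
    using F(2) by (force simp: lipschitz_on_def dist_norm)
  finally show False using closer by simp
qed

text \<open>
  For \<open>u\<close> as in \<open>total_order_not_closed_pointed\<close>, there are vectors above \<open>u\<close> that converge to 0.
  Continuity and closedness of \<open>s\<close> force every monotone 1-Lipschitz map to satisfy \<open>F 0 \<succeq> F u\<close>; as
  also \<open>F u \<succeq> F 0\<close>, such a map identifies 0 and \<open>u\<close>. But there is an order-preserving isometry of
  \<open>{0, u}\<close> onto \<open>{0, y}\<close> with \<open>y\<close> positive and nonzero.
\<close>

lemma no_extension_total: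
  fixes r :: "('a::real_inner \<times> 'a) set" and s :: "('b::{real_inner, complete_space} \<times> 'b) set"
  assumes r: "vector_order r" "total r" and dim: "\<exists>B::'a set. independent B \<and> card B = 2"
    and s: "hilbert_poset s" "s \<noteq> Id"
  shows "\<not> monotone_lipschitz_extension_property r s"
proof
  assume ext: "monotone_lipschitz_extension_property r s"
  have s': "vector_order s" "closed s" using s by (auto simp: hilbert_poset_def)
  obtain u where u: "u \<in> positive_cone r" "u \<noteq> 0" "- u \<in> closure (positive_cone r)"
    using total_order_not_closed_pointed[OF r dim] by blast
  obtain q where q: "q \<in> positive_cone s" "q \<noteq> 0"
    using vector_order_Id_iff[OF s'(1)] s(2) by blast
  define y where "y = (norm u / norm q) *\<^sub>R q"
  have y: "(y, 0) \<in> s" "y \<noteq> 0" "norm y = norm u"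
    using positive_cone_scale[OF s'(1) _ q(1)] q(2) u(2) by (auto simp: y_def positive_cone_def)
  obtain F where F: "order_preserving_on UNIV r s F" "1-lipschitz_on UNIV F" "F 0 = 0" "F u = y"
  proof (rule extension_from_two_points[OF ext])
    show "(x, x) \<in> s" for x by (rule vector_order_refl[OF s'(1)])
    show "0 \<noteq> u" using u by blast
    show "(0, y) \<in> s" if "(0, u) \<in> r"
      using that u positive_cone_pointed[OF r(1), of u] by (simp add: positive_cone_uminus[OF r(1)])
    show "(y, 0) \<in> s" by (rule y)
    show "dist 0 y \<le> dist 0 u" using y by simp
  qed
  obtain p where p: "\<And>n. p n \<in> positive_cone r" "p \<longlonglongrightarrow> - u"
    using u(3) by (auto simp: closure_sequential)
  have "isCont F 0"
    using lipschitz_on_continuous_on[OF F(2)] by (simp add: continuous_on_eq_continuous_at)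
  moreover have "(\<lambda>n. p n + u) \<longlonglongrightarrow> 0"
    using tendsto_add[OF p(2) tendsto_const[of u]] by simp
  ultimately have "(\<lambda>n. F (p n + u)) \<longlonglongrightarrow> F 0"
    by (rule isCont_tendsto_compose)
  then have "(\<lambda>n. (F (p n + u), F u)) \<longlonglongrightarrow> (F 0, F u)"
    by (intro tendsto_Pair tendsto_const)
  moreover have "(F (p n + u), F u) \<in> s" for n
  proof -
    have "(p n + u, u) \<in> r" using p(1) by (simp add: positive_cone_iff[OF r(1)])
    then show ?thesis using F(1) by (simp add: order_preserving_on_def)
  qed
  ultimately have "(F 0, F u) \<in> s"
    using closed_sequentially[OF s'(2), of "\<lambda>n. (F (p n + u), F u)"] by blast
  then have "(0, y) \<in> s" using F by simp
  with y show False using vector_order_antisym[OF s'(1)] by blast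
qed

section \<open>The characterization\<close>

theorem mainTheorem1:
  fixes rX :: "('a::{real_inner, complete_space} \<times> 'a) set"
    and rY :: "('b::{real_inner, complete_space} \<times> 'b) set"
  assumes "vector_order rX"
    and dim_ge_2: "\<exists>B::'a set. independent B \<and> card B = 2"
    and "hilbert_poset rY"
    and nonzero_Y: "\<exists>y::'b. y \<noteq> 0"
    and nondegenerate: "\<not> (rY = Id \<and> total rX)"
  shows "monotone_lipschitz_extension_property rX rY \<longleftrightarrow> rX = Id"
proof
  assume ext: "monotone_lipschitz_extension_property rX rY"
  show "rX = Id"
  proof (cases "total rX")
    case True
    then show ?thesis
      using no_extension_total[OF assms(1) True dim_ge_2 assms(3)] nondegenerate ext by blast
  next
    case False
    then show ?thesis
      using no_extension_nontotal[OF assms(1) _ False assms(3) nonzero_Y] ext by blast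
  qed
next
  assume trivial: "rX = Id"
  have refl: "(y, y) \<in> rY" for y
    using assms(3) vector_order_refl by (auto simp: hilbert_poset_def)
  show "monotone_lipschitz_extension_property rX rY"
    unfolding monotone_lipschitz_extension_property_def
  proof (intro allI impI)
    fix S :: "'a set" and f :: "'a \<Rightarrow> 'b"
    assume "1-lipschitz_on S f"
    then obtain F where "1-lipschitz_on UNIV F" "\<And>x. x \<in> S \<Longrightarrow> F x = f x"
      using kirszbraun by blast
    moreover have "order_preserving_on UNIV rX rY F"
      using refl by (simp add: order_preserving_on_def trivial)
    ultimately show "\<exists>F. order_preserving_on UNIV rX rY F \<and> 1-lipschitz_on UNIV F \<and> (\<forall>x\<in>S. F x = f x)"
      by blast
  qed
qed

end
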